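(* Let $X_1,X_2\in\mathbb{R}^{n\times n}_+$. Then $$\mathcal{P}_{sk}(X_1\circ X_2)=\mathcal{P}_{sk}\big(\mathcal{P}_{sk}(X_1)\circ X_2\big).$$
   Context: $\mathbb{R}^{n\times n}_+$ (resp. $\mathbb{R}^n_+$) denotes the real $n\times n$ matrices (resp. $n$-vectors) with all entries strictly positive. For a vector $\mathbf{x}$, $D_{(\mathbf{x})}$ is the diagonal matrix with diagonal $\mathbf{x}$. A matrix is doubly stochastic if it is entrywise nonnegative with all row sums and all column sums equal to $1$. $\circ$ is the Hadamard (entrywise) product. Sinkhorn operator: for $Y\in\mathbb{R}^{n\times n}_+$, $\mathcal{P}_{sk}(Y)=D_{(\mathbf r)}YD_{(\mathbf c)}$, where $\mathbf r,\mathbf c\in\mathbb{R}^n_+$ are balancing vectors, i.e. such that $D_{(\mathbf r)}YD_{(\mathbf c)}$ is doubly stochastic (by Sinkhorn's theorem such vectors exist and the resulting doubly stochastic matrix is unique). *)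

theory Defs
  imports "HOL-Analysis.Analysis"
begin

definition pos_vector :: "real ^ 'n \<Rightarrow> bool" where
  "pos_vector x \<longleftrightarrow> (\<forall>i. 0 < x $ i)"

definition pos_matrix :: "real ^ 'n ^ 'm \<Rightarrow> bool" where
  "pos_matrix A \<longleftrightarrow> (\<forall>i j. 0 < A $ i $ j)"

definition diag_matrix :: "real ^ 'n \<Rightarrow> real ^ 'n ^ 'n" where
  "diag_matrix x = (\<chi> i j. if i = j then x $ i else 0)"

definition doubly_stochastic :: "real ^ 'n ^ 'n \<Rightarrow> bool" where
  "doubly_stochastic A \<longleftrightarrow>
     (\<forall>i j. 0 \<le> A $ i $ j) \<and>
     (\<forall>i. (\<Sum>j\<in>UNIV. A $ i $ j) = 1) \<and>
     (\<forall>j. (\<Sum>i\<in>UNIV. A $ i $ j) = 1)"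

(* Multiplication on the vector type is componentwise at both index levels, so on
   matrices it is the entrywise product; the matrix product is written **. *)
abbreviation hadamard :: "real ^ 'n ^ 'm \<Rightarrow> real ^ 'n ^ 'm \<Rightarrow> real ^ 'n ^ 'm"
    (infixl "\<circ>\<^sub>H" 70) where
  "A \<circ>\<^sub>H B \<equiv> A * B"

lemma hadamard_nth: "(A \<circ>\<^sub>H B) $ i $ j = A $ i $ j * B $ i $ j"
  by simp

definition balancing :: "real ^ 'n ^ 'n \<Rightarrow> real ^ 'n \<Rightarrow> real ^ 'n \<Rightarrow> bool" where
  "balancing Y r c \<longleftrightarrow> pos_vector r \<and> pos_vector c \<and>
     doubly_stochastic (diag_matrix r ** Y ** diag_matrix c)"

(* The balancing vectors are determined only up to (r, c) \<mapsto> (t r, c / t), so the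
   description selects the scaled matrix rather than the vectors. For entrywise
   positive Y, it is well-defined by Sinkhorn's theorem; otherwise the value need not
   be meaningful. *)
definition sinkhorn :: "real ^ 'n ^ 'n \<Rightarrow> real ^ 'n ^ 'n" where
  "sinkhorn Y = (THE Z. \<exists>r c. balancing Y r c \<and> Z = diag_matrix r ** Y ** diag_matrix c)"

end

(* For a positive matrix A, a fixed point of the normalisation of
   x \<mapsto> 1 / (A\<^sup>T (1 / (A x))) on the standard simplex (Brouwer) gives the balancing vectors
   c = x and r = 1 / (A x). Uniqueness of the balanced matrix is a maximum principle: if Z and
   D_u Z D_v are doubly stochastic and Z is positive, look at a column where v is maximal.
   Hence P_sk(X1) = D_a X1 D_b for some positive a, b, and the positive scalings of X1 \<circ> X2 are
   the same as those of (D_a X1 D_b) \<circ> X2 = D_a (X1 \<circ> X2) D_b. *)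
theory Submission
  imports Defs
begin

lemma diag_scale_nth:
  fixes A :: "real^'b^'a"
  shows "(diag_matrix r ** A ** diag_matrix c) $ i $ j = r $ i * A $ i $ j * c $ j"
proof -
  have left: "(diag_matrix r ** B) $ i $ k = r $ i * B $ i $ k" for B :: "real^'b^'a" and k
    by (simp add: matrix_matrix_mult_def diag_matrix_def if_distrib[of "\<lambda>x. x * _"] sum.delta
        cong: if_cong)
  have right: "(B ** diag_matrix c) $ i $ j = B $ i $ j * c $ j" for B :: "real^'b^'a"
    by (simp add: matrix_matrix_mult_def diag_matrix_def if_distrib[of "\<lambda>x. _ * x"] sum.delta
        cong: if_cong)
  show ?thesis
    by (simp only: left right)
qed

lemma diag_scale_mult:
  "diag_matrix r ** (diag_matrix a ** A ** diag_matrix b) ** diag_matrix c =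
   diag_matrix (r * a) ** A ** diag_matrix (c * b)"
  by (simp add: vec_eq_iff diag_scale_nth)

lemma diag_scale_hadamard:
  "(diag_matrix a ** A ** diag_matrix b) \<circ>\<^sub>H B = diag_matrix a ** (A \<circ>\<^sub>H B) ** diag_matrix b"
  by (simp add: vec_eq_iff diag_scale_nth)

lemma compact_std_simplex_cart: "compact {x::real^'n. (\<forall>i. 0 \<le> x $ i) \<and> (\<Sum>i\<in>UNIV. x $ i) = 1}"
  (is "compact ?S")
proof -
  have "closed ?S"
    by (intro closed_Collect_conj closed_Collect_all closed_Collect_le closed_Collect_eq
        continuous_intros)
  moreover have "norm x \<le> 1" if "x \<in> ?S" for x
    using norm_le_l1_cart[of x] that by simp
  then have "bounded ?S"
    by (intro boundedI)
  ultimately show ?thesis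
    by (simp add: compact_eq_bounded_closed)
qed

lemma convex_std_simplex_cart: "convex {x::real^'n. (\<forall>i. 0 \<le> x $ i) \<and> (\<Sum>i\<in>UNIV. x $ i) = 1}"
  by (auto simp: convex_def sum.distrib sum_distrib_left[symmetric])

lemma ex_balancing:
  fixes A :: "real^'n^'n"
  assumes "pos_matrix A"
  shows "\<exists>r c. balancing A r c"
proof -
  define S where "S = {x::real^'n. (\<forall>i. 0 \<le> x $ i) \<and> (\<Sum>i\<in>UNIV. x $ i) = 1}"
  define R where "R x i = (\<Sum>j\<in>UNIV. A $ i $ j * x $ j)" for x :: "real^'n" and i
  \<comment> \<open>With row \<open>i\<close> divided by \<open>R x i\<close>, column
    \<open>j\<close> of \<open>A\<close> sums to \<open>C x j\<close>, so \<open>1 / C x j\<close>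
    is the column factor that repairs it. Thus \<open>f\<close> is one sweep of row and column
    normalisation acting on column factors, and dividing by \<open>N x\<close> brings the result
    back to the simplex.\<close>
  define C where "C x j = (\<Sum>i\<in>UNIV. A $ i $ j / R x i)" for x j
  define N where "N x = (\<Sum>j\<in>UNIV. 1 / C x j)" for x
  define f :: "real^'n \<Rightarrow> real^'n" where "f x = (\<chi> j. (1 / C x j) / N x)" for x
  have A: "0 < A $ i $ j" for i j
    using assms by (simp add: pos_matrix_def)
  \<comment> \<open>Strict positivity of \<open>A\<close> makes \<open>R x\<close> positive even on
    the boundary faces of \<open>S\<close>, so every division below is safe and \<open>f\<close> is
    continuous on all of the compact set \<open>S\<close>.\<close>
  have R: "0 < R x i" if "x \<in> S" for x i
  proof -
    have "\<exists>j. x $ j \<noteq> 0"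
      using that sum.neutral[of UNIV "\<lambda>j. x $ j"] unfolding S_def mem_Collect_eq
      by (metis zero_neq_one)
    then obtain j where "x $ j \<noteq> 0" ..
    then have "0 < x $ j"
      using that by (simp add: S_def less_le)
    then show ?thesis
      unfolding R_def using A that
      by (intro sum_pos2[of _ j]) (auto simp: S_def less_imp_le)
  qed
  have C: "0 < C x j" if "x \<in> S" for x j
    unfolding C_def using A R[OF that] by (intro sum_pos) auto
  have N: "0 < N x" if "x \<in> S" for x
    unfolding N_def using C[OF that] by (intro sum_pos) auto
  have R0: "R x i \<noteq> 0" and C0: "C x i \<noteq> 0" and N0: "N x \<noteq> 0" if "x \<in> S" for x i
    using R[OF that, of i] C[OF that, of i] N[OF that] by auto
  have "continuous_on S (\<lambda>x. R x i)" for i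
    unfolding R_def by (intro continuous_intros)
  then have "continuous_on S (\<lambda>x. C x j)" for j
    unfolding C_def using R0 by (intro continuous_intros) auto
  moreover from this have "continuous_on S N"
    unfolding N_def using C0 by (intro continuous_intros) auto
  ultimately have cont: "continuous_on S f"
    unfolding f_def using C0 N0 by (intro continuous_intros) auto
  have maps: "f \<in> S \<rightarrow> S"
  proof (rule Pi_I)
    fix x assume x: "x \<in> S"
    have "(\<Sum>j\<in>UNIV. f x $ j) = (\<Sum>j\<in>UNIV. 1 / C x j) / N x"
      by (simp only: f_def vec_lambda_beta sum_divide_distrib)
    also have "\<dots> = 1"
      unfolding N_def[symmetric] using N0[OF x] by simp
    finally show "f x \<in> S"
      using C[OF x] N[OF x] by (simp add: S_def f_def less_imp_le)
  qed
  \<comment> \<open>Any vertex of the simplex will do; \<open>undefined\<close> is just some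
    index.\<close>
  have "axis undefined 1 \<in> S"
    by (simp add: S_def axis_def)
  then have ne: "S \<noteq> {}" by auto
  have "compact S" "convex S"
    unfolding S_def by (rule compact_std_simplex_cart convex_std_simplex_cart)+
  then obtain x where x: "x \<in> S" and fx: "f x = x"
    using brouwer[OF _ _ ne cont maps] by blast
  \<comment> \<open>A fixed point is a value of \<open>f\<close>, hence off the boundary of the
    simplex and usable as a positive scaling.\<close>
  have x_eq: "x $ j = 1 / C x j / N x" for j
    using fx unfolding f_def by (metis vec_lambda_beta)
  then have x_pos: "0 < x $ j" for j
    using C[OF x] N[OF x] by simp
  define r :: "real^'n" where "r = (\<chi> i. 1 / R x i)"
  let ?Z = "diag_matrix r ** A ** diag_matrix x"
  have row: "(\<Sum>j\<in>UNIV. ?Z $ i $ j) = 1" for i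
  proof -
    have "(\<Sum>j\<in>UNIV. ?Z $ i $ j) = (\<Sum>j\<in>UNIV. A $ i $ j * x $ j) / R x i"
      by (simp add: diag_scale_nth r_def sum_divide_distrib)
    then show ?thesis
      using R0[OF x] by (simp add: R_def[symmetric])
  qed
  \<comment> \<open>The fixed point equation reads \<open>C x j * x $ j = 1 / N x\<close>: the
    column sums agree, with their common value still to be found.\<close>
  have col: "(\<Sum>i\<in>UNIV. ?Z $ i $ j) = 1 / N x" for j
  proof -
    have "(\<Sum>i\<in>UNIV. ?Z $ i $ j) = C x j * x $ j"
      by (simp add: C_def diag_scale_nth r_def sum_distrib_right)
    then show ?thesis
      using C0[OF x] x_eq[of j] by simp
  qed
  \<comment> \<open>Summing all entries by rows and by columns identifies the normalising constant.\<close>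
  have "(\<Sum>j\<in>UNIV. \<Sum>i\<in>UNIV. ?Z $ i $ j) = (\<Sum>i\<in>UNIV. \<Sum>j\<in>UNIV. ?Z $ i $ j)"
    by (rule sum.swap)
  then have "N x = 1"
    unfolding row col using N0[OF x] by (simp add: divide_eq_eq)
  then have "balancing A r x"
    unfolding balancing_def pos_vector_def doubly_stochastic_def
    using row col A R[OF x] x_pos by (auto simp: diag_scale_nth r_def less_imp_le)
  then show ?thesis by blast
qed

lemma doubly_stochastic_scaling_eq:
  fixes Z :: "real^'n^'n"
  assumes pos: "pos_matrix Z" and ds: "doubly_stochastic Z" and bal: "balancing Z u v"
  shows "diag_matrix u ** Z ** diag_matrix v = Z"
proof -
  have Z: "0 < Z $ i $ j" for i j
    using pos by (simp add: pos_matrix_def)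
  have u: "0 < u $ i" and v: "0 < v $ i" for i
    using bal by (simp_all add: balancing_def pos_vector_def)
  have rowZ: "(\<Sum>j\<in>UNIV. Z $ i $ j) = 1" and colZ: "(\<Sum>j\<in>UNIV. Z $ j $ i) = 1" for i
    using ds by (simp_all add: doubly_stochastic_def)
  have row: "u $ i * (\<Sum>j\<in>UNIV. Z $ i $ j * v $ j) = 1" for i
    using bal by (simp add: balancing_def doubly_stochastic_def diag_scale_nth sum_distrib_left
        mult.assoc)
  have col: "(\<Sum>i\<in>UNIV. Z $ i $ j * u $ i) * v $ j = 1" for j
    using bal by (simp add: balancing_def doubly_stochastic_def diag_scale_nth sum_distrib_right
        mult.commute[of "u $ _"])
  obtain k where k: "v $ j \<le> v $ k" for j
  proof -
    have "Max (range (($) v)) \<in> range (($) v)"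
      by (intro Max_in) auto
    then obtain k where "Max (range (($) v)) = v $ k" by (rule imageE)
    then have "v $ j \<le> v $ k" for j
      by (metis Max_ge finite_class.finite_UNIV finite_imageI rangeI)
    then show ?thesis by (rule that)
  qed
  define M where "M = v $ k"
  have M: "0 < M" "v $ j \<le> M" for j
    using v k by (simp_all add: M_def)
  \<comment> \<open>Since the rows of \<open>Z\<close> sum to 1, \<open>1 / u $ i\<close> is a
    weighted average of the entries of \<open>v\<close>, so at most \<open>M\<close>.\<close>
  have u_ge: "1 / M \<le> u $ i" for i
  proof -
    have "(\<Sum>j\<in>UNIV. Z $ i $ j * v $ j) \<le> (\<Sum>j\<in>UNIV. Z $ i $ j * M)"
      using Z M by (intro sum_mono mult_left_mono) (auto simp: less_imp_le)
    also have "\<dots> = M"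
      by (simp add: sum_distrib_right[symmetric] rowZ)
    finally have "1 \<le> u $ i * M"
      using row[of i] mult_left_mono[OF _ less_imp_le[OF u[of i]]] by metis
    then show ?thesis
      using M by (simp add: field_simps)
  qed
  \<comment> \<open>As \<open>v $ k = M\<close>, the average of \<open>u\<close> with the weights in
    column \<open>k\<close> is exactly its lower bound \<open>1 / M\<close>. Positive weights then
    force equality in every entry.\<close>
  have "(\<Sum>i\<in>UNIV. Z $ i $ k * (u $ i - 1 / M)) = 0"
    using col[of k] M(1)
    by (simp add: right_diff_distrib sum_subtractf sum_divide_distrib[symmetric] colZ
        M_def[symmetric] eq_divide_eq)
  then have u_eq: "u $ i = 1 / M" for i
    using Z[of i k] u_ge Z
    by (subst (asm) sum_nonneg_eq_0_iff) (auto simp: less_imp_le less_imp_neq[symmetric])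
  have "v $ j = M" for j
  proof -
    \<comment> \<open>Now each row average of \<open>v\<close> is \<open>1 / u $ j0 = M\<close>, its
      upper bound, so the same argument makes \<open>v\<close> constant.\<close>
    have "(\<Sum>j\<in>UNIV. Z $ j0 $ j * (M - v $ j)) = 0" for j0
      using row[of j0] M(1) u_eq
      by (simp add: right_diff_distrib sum_subtractf sum_distrib_right[symmetric] rowZ field_simps)
    then have "Z $ j $ j * (M - v $ j) = 0"
      using Z M(2) by (subst (asm) sum_nonneg_eq_0_iff) (auto simp: less_imp_le)
    then show ?thesis
      using Z[of j j] by simp
  qed
  then show ?thesis
    using M(1) by (simp add: vec_eq_iff diag_scale_nth u_eq)
qed

lemma balancing_diag_scale:
  assumes "pos_vector a" and "pos_vector b"
  shows "balancing (diag_matrix a ** A ** diag_matrix b) r c \<longleftrightarrow> balancing A (r * a) (c * b)"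
proof -
  have "0 < x * y \<longleftrightarrow> 0 < x" if "0 < y" for x y :: real
    using that by (simp add: zero_less_mult_iff)
  then show ?thesis
    using assms by (simp add: balancing_def pos_vector_def diag_scale_mult)
qed

text \<open>The map from \<open>(r, c)\<close> to \<open>(r * a, c * b)\<close> is a bijection on
  pairs of positive vectors, so the predicates under the two \<open>THE\<close> descriptions
  coincide.\<close>

lemma sinkhorn_diag_scale:
  fixes A :: "real^'n^'n"
  assumes a: "pos_vector a" and b: "pos_vector b"
  shows "sinkhorn (diag_matrix a ** A ** diag_matrix b) = sinkhorn A"
proof -
  \<comment> \<open>Componentwise quotients invert this map, which gives the backward
    direction.\<close>
  have inv: "(\<chi> i. r $ i / x $ i) * x = r" if "pos_vector x" for r x :: "real^'n"
    using that by (simp add: pos_vector_def vec_eq_iff less_imp_neq[symmetric])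
  have "(\<exists>r c. balancing (diag_matrix a ** A ** diag_matrix b) r c \<and>
          Z = diag_matrix r ** (diag_matrix a ** A ** diag_matrix b) ** diag_matrix c) \<longleftrightarrow>
        (\<exists>r c. balancing A r c \<and> Z = diag_matrix r ** A ** diag_matrix c)" for Z
    unfolding balancing_diag_scale[OF a b] diag_scale_mult
  proof (intro iffI; elim exE)
    fix r c
    assume "balancing A r c \<and> Z = diag_matrix r ** A ** diag_matrix c"
    then show "\<exists>r c. balancing A (r * a) (c * b) \<and>
        Z = diag_matrix (r * a) ** A ** diag_matrix (c * b)"
      by (intro exI[of _ "\<chi> i. r $ i / a $ i"] exI[of _ "\<chi> i. c $ i / b $ i"])
        (simp only: inv[OF a] inv[OF b])
  qed blast
  then show ?thesis
    by (simp add: sinkhorn_def)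
qed

text \<open>Scaling invariance moves the claim from \<open>A\<close> to the balanced matrix
  \<open>?Z\<close>. There the vectors \<open>1\<close> and \<open>1\<close> balance, and by
  \<open>doubly_stochastic_scaling_eq\<close> every other balanced scaling of \<open>?Z\<close> is
  again \<open>?Z\<close>.\<close>

lemma sinkhorn_eq:
  assumes A: "pos_matrix A" and bal: "balancing A r c"
  shows "sinkhorn A = diag_matrix r ** A ** diag_matrix c"
proof -
  let ?Z = "diag_matrix r ** A ** diag_matrix c"
  have rc: "pos_vector r" "pos_vector c" and ds: "doubly_stochastic ?Z"
    using bal by (simp_all add: balancing_def)
  have pos: "pos_matrix ?Z"
    using A rc by (simp add: pos_matrix_def pos_vector_def diag_scale_nth)
  have one: "diag_matrix 1 ** ?Z ** diag_matrix 1 = ?Z"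
    by (simp add: vec_eq_iff diag_scale_nth)
  then have "balancing ?Z 1 1"
    using ds by (simp add: balancing_def pos_vector_def)
  then have "sinkhorn ?Z = ?Z"
    unfolding sinkhorn_def using one[symmetric]
    by (intro the_equality) (blast, auto simp only: doubly_stochastic_scaling_eq[OF pos ds])
  then show ?thesis
    by (simp add: sinkhorn_diag_scale[OF rc])
qed

theorem lemma2:
  fixes X1 X2 :: "real ^ 'n ^ 'n"
  assumes "pos_matrix X1" and "pos_matrix X2"
  shows "sinkhorn (X1 \<circ>\<^sub>H X2) = sinkhorn (sinkhorn X1 \<circ>\<^sub>H X2)"
proof -
  obtain r c where bal: "balancing X1 r c"
    using ex_balancing[OF assms(1)] by blast
  then have "pos_vector r" "pos_vector c"
    by (simp_all add: balancing_def)
  then show ?thesis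
    by (simp add: sinkhorn_eq[OF assms(1) bal] diag_scale_hadamard sinkhorn_diag_scale)
qed

end
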